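(* Let $A=\begin{bmatrix} A_{11} & A_{12} \\ A_{21} & A_{22} \end{bmatrix}\in M_n(\mathbb{C})$ be a square block $2$ by $2$ matrix, with square diagonal blocks, such that $A_{11}$ is invertible. Then $$\operatorname{Im}\operatorname{PPT}(A)=\begin{bmatrix} A_{11}^{-1} & -A_{11}^{-1}A_{12} \\ 0 & 1 \end{bmatrix}^*\,(\operatorname{Im}A)\,\begin{bmatrix} A_{11}^{-1} & -A_{11}^{-1}A_{12} \\ 0 & 1 \end{bmatrix},$$ where $1$ denotes the identity matrix of the size of $A_{22}$.
   Context: For $A=\begin{bmatrix} A_{11} & A_{12} \\ A_{21} & A_{22} \end{bmatrix}\in M_n(\mathbb{C})$ partitioned into blocks, with $A_{11}$ and $A_{22}$ square (not necessarily of the same size) and $A_{11}$ invertible, the principal pivot transform of $A$ is the matrix (with the same partition) $$\operatorname{PPT}(A)=\begin{bmatrix} -A_{11}^{-1} & A_{11}^{-1}A_{12} \\ A_{21}A_{11}^{-1} & A_{22}-A_{21}A_{11}^{-1}A_{12} \end{bmatrix}.$$ The imaginary part of a square complex matrix $A$ is $\operatorname{Im}A=\frac{A-A^*}{2i}$, where $A^*$ is the conjugate transpose. *)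

theory Defs
  imports "Jordan_Normal_Form.Schur_Decomposition"
begin

text \<open>The library's \<^const>\<open>mat_inverse\<close> returns an option; it is
  \<^const>\<open>None\<close> exactly for non-invertible matrices, so \<open>mat_inv\<close> is only
  meaningful under the hypothesis \<^const>\<open>invertible_mat\<close>.\<close>

definition mat_inv :: "'a :: field mat \<Rightarrow> 'a mat" where
  "mat_inv A = the (mat_inverse A)"

lemma mat_inv:
  assumes A: "A \<in> carrier_mat n n" and inv: "invertible_mat A"
  shows "A * mat_inv A = 1\<^sub>m n" "mat_inv A * A = 1\<^sub>m n" "mat_inv A \<in> carrier_mat n n"
proof -
  from inv obtain B where B: "A * B = 1\<^sub>m n" "B * A = 1\<^sub>m (dim_row B)"
    using A unfolding invertible_mat_def inverts_mat_def by auto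
  from arg_cong[OF B(1), of dim_col] arg_cong[OF B(2), of dim_col] A
  have "B \<in> carrier_mat n n" by auto
  with A B have "A \<in> Units (ring_mat TYPE('a) n ())"
    by (auto simp: Units_def ring_mat_def)
  with mat_inverse(1)[OF A, where b = "()"] have "mat_inverse A \<noteq> None" by blast
  then have "mat_inverse A = Some (mat_inv A)" by (auto simp: mat_inv_def)
  from mat_inverse(2)[OF A this]
  show "A * mat_inv A = 1\<^sub>m n" "mat_inv A * A = 1\<^sub>m n" "mat_inv A \<in> carrier_mat n n"
    by auto
qed

text \<open>The partition is recorded by the size \<open>k\<close> of the leading block.\<close>

definition ppt :: "nat \<Rightarrow> 'a :: field mat \<Rightarrow> 'a mat" where
  "ppt k A = (case split_block A k k of (A11, A12, A21, A22) \<Rightarrow>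
     four_block_mat
       (- mat_inv A11)        (mat_inv A11 * A12)
       (A21 * mat_inv A11)    (A22 - A21 * mat_inv A11 * A12))"

lemma ppt_four_block_mat:
  assumes "A11 \<in> carrier_mat k k" "A12 \<in> carrier_mat k m"
    and "A21 \<in> carrier_mat m k" "A22 \<in> carrier_mat m m"
  shows "ppt k (four_block_mat A11 A12 A21 A22) =
    four_block_mat
      (- mat_inv A11)        (mat_inv A11 * A12)
      (A21 * mat_inv A11)    (A22 - A21 * mat_inv A11 * A12)"
proof -
  have "split_block (four_block_mat A11 A12 A21 A22) k k = (A11, A12, A21, A22)"
    using assms unfolding split_block_def Let_def by auto
  then show ?thesis by (simp add: ppt_def)
qed

definition Im_mat :: "complex mat \<Rightarrow> complex mat" where
  "Im_mat A = (1 / (2 * \<i>)) \<cdot>\<^sub>m (A - mat_adjoint A)"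

end

theory Submission
  imports Defs
begin

text \<open>Write \<open>X\<close> for the block matrix on the right. Then \<open>PPT(A) = X\<^sup>* A X + H\<close> with
  \<open>H\<close> Hermitian, \<open>H = [[-B - B\<^sup>*, B A\<^sub>1\<^sub>2], [(B A\<^sub>1\<^sub>2)\<^sup>*, 0]]\<close> for \<open>B = A\<^sub>1\<^sub>1\<^sup>-\<^sup>1\<close>, so both
  \<open>PPT(A)\<close> and \<open>X\<^sup>* A X\<close> have the same imaginary part, and \<open>Im (X\<^sup>* A X) = X\<^sup>* (Im A) X\<close>.\<close>

lemma index_mat_adjoint [simp]:
  "i < dim_col A \<Longrightarrow> j < dim_row A \<Longrightarrow> mat_adjoint A $$ (i, j) = conjugate (A $$ (j, i))"
  by (simp add: mat_adjoint_def mat_of_rows_def)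

lemma dim_mat_adjoint [simp]:
  "dim_row (mat_adjoint A) = dim_col A" "dim_col (mat_adjoint A) = dim_row A"
  by (simp_all add: mat_adjoint_def)

lemma mat_adjoint_carrier [simp]:
  "A \<in> carrier_mat n m \<Longrightarrow> mat_adjoint A \<in> carrier_mat m n"
  by (intro carrier_matI) auto

lemma mat_adjoint_four_block_mat:
  assumes "A11 \<in> carrier_mat k l" "A12 \<in> carrier_mat k m"
    and "A21 \<in> carrier_mat n l" "A22 \<in> carrier_mat n m"
  shows "mat_adjoint (four_block_mat A11 A12 A21 A22) =
    four_block_mat (mat_adjoint A11) (mat_adjoint A21) (mat_adjoint A12) (mat_adjoint A22)"
  using assms by (intro eq_matI) auto

lemma mat_adjoint_uminus:
  fixes A :: "'a :: conjugatable_field mat"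
  shows "mat_adjoint (- A) = - mat_adjoint A"
  by (intro eq_matI) (auto simp: conjugate_neg)

lemma mat_adjoint_add:
  fixes A B :: "'a :: conjugatable_field mat"
  assumes "A \<in> carrier_mat n m" "B \<in> carrier_mat n m"
  shows "mat_adjoint (A + B) = mat_adjoint A + mat_adjoint B"
  using assms by (intro eq_matI) (auto simp: conjugate_dist_add)

lemma mat_adjoint_mat_adjoint [simp]:
  fixes A :: "'a :: conjugatable_field mat"
  shows "mat_adjoint (mat_adjoint A) = A"
  by (intro eq_matI) auto

text \<open>Conjugation is multiplicative and an involution, so with c the conjugate of 1, c = c * 1
  = c * conjugate c = conjugate (1 * c) = 1.\<close>

lemma conjugate_one [simp]: "conjugate (1 :: 'a :: conjugatable_field) = 1"
  by (metis conjugate_dist_mul conjugate_id mult_1_left mult_1_right)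

lemma mat_adjoint_one [simp]: "mat_adjoint (1\<^sub>m n :: 'a :: conjugatable_field mat) = 1\<^sub>m n"
  by (intro eq_matI) auto

lemma mat_adjoint_zero [simp]: "mat_adjoint (0\<^sub>m n m :: 'a :: conjugatable_field mat) = 0\<^sub>m m n"
  by (intro eq_matI) auto

lemma mat_adjoint_mult:
  fixes A B :: "'a :: conjugatable_field mat"
  assumes "A \<in> carrier_mat n m" "B \<in> carrier_mat m l"
  shows "mat_adjoint (A * B) = mat_adjoint B * mat_adjoint A"
  using assms by (intro eq_matI) (auto simp: scalar_prod_def sum_conjugate conjugate_dist_mul mult.commute)

text \<open>In the difference of \<open>A + H\<close> and its adjoint, \<open>H\<close> cancels
  against itself.\<close>

lemma Im_mat_add_hermitian:
  assumes "A \<in> carrier_mat n n" "H \<in> carrier_mat n n" "mat_adjoint H = H"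
  shows "Im_mat (A + H) = Im_mat A"
proof -
  have "A + H - mat_adjoint (A + H) = A - mat_adjoint A"
    unfolding mat_adjoint_add[OF assms(1,2)] assms(3)
    using assms(1,2) by (intro eq_matI) auto
  then show ?thesis by (simp add: Im_mat_def)
qed

text \<open>Taking adjoints commutes with the congruence by \<open>X\<close>, and the congruence is
  linear in its middle factor, so the difference and the scalar in \<open>Im_mat\<close> both pass
  inside.\<close>

lemma Im_mat_congruence:
  assumes A: "A \<in> carrier_mat n n" and X: "X \<in> carrier_mat n m"
  shows "Im_mat (mat_adjoint X * A * X) = mat_adjoint X * Im_mat A * X"
proof -
  note carr = A X mat_adjoint_carrier[OF A] mat_adjoint_carrier[OF X]
  have "mat_adjoint (mat_adjoint X * A * X) = mat_adjoint X * mat_adjoint A * X"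
    using carr by (simp add: mat_adjoint_mult[of _ m n _ m] mat_adjoint_mult[of _ n n _ m]
        assoc_mult_mat[of _ m n _ n _ m])
  then have "mat_adjoint X * A * X - mat_adjoint (mat_adjoint X * A * X) =
      mat_adjoint X * (A - mat_adjoint A) * X"
    using carr by (simp only: mult_minus_distrib_mat[of _ m n _ n]
        minus_mult_distrib_mat[of _ m n _ _ m] mult_carrier_mat[of _ m n _ n])
  moreover have "c \<cdot>\<^sub>m (mat_adjoint X * M * X) = mat_adjoint X * (c \<cdot>\<^sub>m M) * X"
    if "M \<in> carrier_mat n n" for c :: complex and M
    using that carr by (simp add: mult_smult_distrib[of _ m n _ n] mult_smult_assoc_mat[of _ m n _ m]
        mult_carrier_mat[of _ m n _ n])
  ultimately show ?thesis
    using carr by (simp only: Im_mat_def minus_carrier_mat)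
qed

theorem proposition2p1:
  fixes A A11 A12 A21 A22 :: "complex mat" and k m :: nat
  assumes "A11 \<in> carrier_mat k k" and "A12 \<in> carrier_mat k m"
    and "A21 \<in> carrier_mat m k" and "A22 \<in> carrier_mat m m"
    and "A = four_block_mat A11 A12 A21 A22"
    and "invertible_mat A11"
  shows "Im_mat (ppt k A) =
    mat_adjoint (four_block_mat (mat_inv A11) (- (mat_inv A11 * A12)) (0\<^sub>m m k) (1\<^sub>m m))
    * Im_mat A
    * four_block_mat (mat_inv A11) (- (mat_inv A11 * A12)) (0\<^sub>m m k) (1\<^sub>m m)"
proof -
  note A11 = assms(1) and A12 = assms(2) and A21 = assms(3) and A22 = assms(4)
  define B where "B = mat_inv A11"
  define F where "F = B * A12"
  \<comment> \<open>The Schur complement of \<open>A11\<close> in \<open>A\<close>, since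
    \<open>F\<close> is the inverse of \<open>A11\<close> times \<open>A12\<close>.\<close>
  define D where "D = A22 - A21 * F"
  define X where "X = four_block_mat B (- F) (0\<^sub>m m k) (1\<^sub>m m)"
  define H where "H = four_block_mat (- B - mat_adjoint B) F (mat_adjoint F) (0\<^sub>m m m)"
  have B: "B \<in> carrier_mat k k" and AB: "A11 * B = 1\<^sub>m k"
    using mat_inv[OF A11 assms(6)] by (auto simp: B_def)
  have F: "F \<in> carrier_mat k m" using B A12 by (simp add: F_def)
  have C: "A21 * B \<in> carrier_mat m k" using A21 B by simp
  have D: "D \<in> carrier_mat m m" using A22 A21 F by (auto simp: D_def)
  have A: "A \<in> carrier_mat (k + m) (k + m)" using assms by auto
  have X: "X \<in> carrier_mat (k + m) (k + m)" using B F by (auto simp: X_def)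
  have H: "H \<in> carrier_mat (k + m) (k + m)" using B F by (auto simp: H_def)
  have AF: "A11 * F = A12"
    using A11 B A12 AB by (simp add: F_def assoc_mult_mat[of _ k k _ k _ m, symmetric])
  \<comment> \<open>Right multiplication by \<open>X\<close> is a block column elimination: it
    normalises \<open>A11\<close> to the identity and, by \<open>AF\<close>, clears
    \<open>A12\<close>. The lower row of the result is already that of the transform.\<close>
  have "A * X = four_block_mat (A11 * B + A12 * 0\<^sub>m m k) (A11 * (- F) + A12 * 1\<^sub>m m)
      (A21 * B + A22 * 0\<^sub>m m k) (A21 * (- F) + A22 * 1\<^sub>m m)"
    unfolding assms(5) X_def using A11 A12 A21 A22 B F
    by (intro mult_four_block_mat) auto
  also have "A11 * B + A12 * 0\<^sub>m m k = 1\<^sub>m k" using AB A12 by simp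
  also have "A11 * (- F) + A12 * 1\<^sub>m m = 0\<^sub>m k m"
    using A11 A12 F AF by (intro eq_matI) auto
  also have "A21 * B + A22 * 0\<^sub>m m k = A21 * B" using C A22 by simp
  also have "A21 * (- F) + A22 * 1\<^sub>m m = D"
    using A21 A22 F by (intro eq_matI) (auto simp: D_def)
  finally have AX: "A * X = four_block_mat (1\<^sub>m k) (0\<^sub>m k m) (A21 * B) D" .
  have X_adj: "mat_adjoint X =
      four_block_mat (mat_adjoint B) (0\<^sub>m k m) (- mat_adjoint F) (1\<^sub>m m)"
    using B F by (simp add: X_def mat_adjoint_four_block_mat[of _ k k _ m _ m] mat_adjoint_uminus)
  \<comment> \<open>With this bracketing both factors are block lower triangular, so the zero blocks
    kill most terms and \<open>D\<close> survives unchanged.\<close>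
  have "mat_adjoint X * (A * X) = four_block_mat
      (mat_adjoint B * 1\<^sub>m k + 0\<^sub>m k m * (A21 * B)) (mat_adjoint B * 0\<^sub>m k m + 0\<^sub>m k m * D)
      (- mat_adjoint F * 1\<^sub>m k + 1\<^sub>m m * (A21 * B)) (- mat_adjoint F * 0\<^sub>m k m + 1\<^sub>m m * D)"
    unfolding AX X_adj using B F C D
    by (intro mult_four_block_mat[of _ k k _ m _ m _ _ k _ m]) simp_all
  also have "\<dots> = four_block_mat (mat_adjoint B) (0\<^sub>m k m) (- mat_adjoint F + A21 * B) D"
    using B F C D by (simp add: right_mult_one_mat[of _ m k] right_mult_one_mat[of _ k k]
        left_mult_one_mat[of _ m k] left_add_zero_mat[of _ m m] right_add_zero_mat[of _ k k]
        right_mult_zero_mat[of _ m k]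
        left_mult_zero_mat[OF C])
  finally have XAX: "mat_adjoint X * (A * X) =
      four_block_mat (mat_adjoint B) (0\<^sub>m k m) (- mat_adjoint F + A21 * B) D" .
  have "ppt k A = four_block_mat (- B) F (A21 * B) D"
    unfolding assms(5) ppt_four_block_mat[OF assms(1-4)]
    using A21 B A12 by (simp add: D_def F_def B_def assoc_mult_mat[of _ m k _ k _ m])
  \<comment> \<open>\<open>H\<close> is exactly the blockwise discrepancy: it turns
    \<open>mat_adjoint B\<close> into \<open>- B\<close>, supplies the missing \<open>F\<close>, and
    removes \<open>- mat_adjoint F\<close>.\<close>
  also have "\<dots> = mat_adjoint X * (A * X) + H"
  proof -
    have e11: "mat_adjoint B + (- B - mat_adjoint B) = - B"
      using B by (intro eq_matI) auto
    \<comment> \<open>A general \<open>M\<close> keeps the product \<open>A21 * B\<close> from being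
      expanded into scalar products in the entrywise argument.\<close>
    have "- mat_adjoint F + M + mat_adjoint F = M" if "M \<in> carrier_mat m k" for M
      using F that by (intro eq_matI) auto
    note e21 = this[OF C]
    have "mat_adjoint X * (A * X) + H = four_block_mat
        (mat_adjoint B + (- B - mat_adjoint B)) (0\<^sub>m k m + F)
        (- mat_adjoint F + A21 * B + mat_adjoint F) (D + 0\<^sub>m m m)"
      unfolding XAX H_def
      by (intro add_four_block_mat[of _ k k _ m _ m] add_carrier_mat minus_carrier_mat
          mat_adjoint_carrier B F C D zero_carrier_mat)
    then show ?thesis
      by (simp only: e11 e21 left_add_zero_mat[OF F] right_add_zero_mat[OF D])
  qed
  also have "mat_adjoint X * (A * X) = mat_adjoint X * A * X"
    using A X by (simp add: assoc_mult_mat[OF mat_adjoint_carrier[OF X] A X])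
  finally have P: "ppt k A = mat_adjoint X * A * X + H" .
  \<comment> \<open>The adjoint merely swaps the two summands. The off-diagonal blocks of
    \<open>H\<close> are adjoint to each other, so \<open>H\<close> is Hermitian.\<close>
  have "mat_adjoint (- B - mat_adjoint B) = - B - mat_adjoint B"
    using B by (intro eq_matI) (auto simp: algebra_simps)
  then have herm: "mat_adjoint H = H"
    unfolding H_def using B F
    by (subst mat_adjoint_four_block_mat[of _ k k _ m _ m]) auto
  have "Im_mat (ppt k A) = Im_mat (mat_adjoint X * A * X)"
    unfolding P using A X H herm by (intro Im_mat_add_hermitian[of _ "k + m"]) auto
  also have "\<dots> = mat_adjoint X * Im_mat A * X"
    using A X by (rule Im_mat_congruence)
  finally show ?thesis by (simp only: X_def F_def B_def)
qed

end
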